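(* The following two statements are equivalent. (a) For all integers $N\ge k\ge 1$ and every normal operator $T$ on an $N$-dimensional complex Hilbert space, $\Lambda_k(T)=\Omega_k(T)$. (b) For all integers $N\ge k\ge 1$ and every unitary operator $U$ on an $N$-dimensional complex Hilbert space, $\Lambda_k(U)=\Omega_k(U)$.
   Context: Let $T$ be an operator on an $N$-dimensional complex Hilbert space with eigenvalues $\lambda_1,\dots,\lambda_N$ (listed with multiplicity), and let $1\le k\le N$. $\Lambda_k(T)$ is the $k$th (higher-rank) numerical range: the set of $\lambda\in\mathbb{C}$ such that $PTP=\lambda P$ for some orthogonal projection $P$ of rank $k$. $\Omega_k(T)=\bigcap_{S}\operatorname{conv}\{\lambda_j: j\in S\}$, where $S$ runs over all subsets of $\{1,\dots,N\}$ with exactly $N-k+1$ elements. *)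

theory Defs
  imports
    "HOL-Analysis.Convex"
    "HOL-Computational_Algebra.Fundamental_Theorem_Algebra"
    "HOL-Combinatorics.List_Permutation"
    "Jordan_Normal_Form.Schur_Decomposition"
    "Jordan_Normal_Form.DL_Rank"
begin

text \<open>Operators on an \<open>N\<close>-dimensional complex Hilbert space are represented by their matrices
  in an orthonormal basis, i.e. by elements of \<open>carrier_mat N N\<close> acting on the standard inner
  product space; the Hilbert space adjoint is then \<^const>\<open>mat_adjoint\<close>.\<close>

definition normal_op :: "nat \<Rightarrow> complex mat \<Rightarrow> bool" where
  "normal_op N T \<longleftrightarrow> T \<in> carrier_mat N N \<and> mat_adjoint T * T = T * mat_adjoint T"

definition unitary_op :: "nat \<Rightarrow> complex mat \<Rightarrow> bool" where
  "unitary_op N U \<longleftrightarrow> U \<in> carrier_mat N N \<and>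
     mat_adjoint U * U = 1\<^sub>m N \<and> U * mat_adjoint U = 1\<^sub>m N"

definition orth_projection :: "nat \<Rightarrow> complex mat \<Rightarrow> bool" where
  "orth_projection N P \<longleftrightarrow> P \<in> carrier_mat N N \<and> P * P = P \<and> mat_adjoint P = P"

definition higher_rank_range :: "nat \<Rightarrow> complex mat \<Rightarrow> complex set" (\<open>\<Lambda>\<close>) where
  "higher_rank_range k T =
     {z. \<exists>P. orth_projection (dim_row T) P \<and> vec_space.rank (dim_row T) P = k \<and>
             P * T * P = z \<cdot>\<^sub>m P}"

definition eigenvalue_listing :: "complex mat \<Rightarrow> complex list \<Rightarrow> bool" where
  "eigenvalue_listing T ls \<longleftrightarrow> mset ls = proots (char_poly T)"

text \<open>The list \<open>ls\<close> has length \<open>N = dim_row T\<close>; indices run over \<open>{..<N}\<close> instead of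
  \<open>{1..N}\<close>. The choice of the listing is immaterial by \<open>Omega_eq\<close> below.\<close>

definition Omega :: "nat \<Rightarrow> complex mat \<Rightarrow> complex set" (\<open>\<Omega>\<close>) where
  "Omega k T =
     (let ls = (SOME ls. eigenvalue_listing T ls); N = dim_row T in
       \<Inter>S \<in> {S. S \<subseteq> {..<N} \<and> card S = N - k + 1}. convex hull ((\<lambda>j. ls ! j) ` S))"

lemma eigenvalue_listing_exists: "\<exists>ls. eigenvalue_listing T ls"
  unfolding eigenvalue_listing_def by (rule ex_mset)

lemma eigenvalue_listing_char_poly:
  assumes "T \<in> carrier_mat N N" and "eigenvalue_listing T ls"
  shows "length ls = N" and "char_poly T = (\<Prod>a\<leftarrow>ls. [:- a, 1:])"
proof -
  have deg: "degree (char_poly T) = N" and lc: "lead_coeff (char_poly T) = 1"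
    using degree_monic_char_poly[OF assms(1)] by auto
  have ms: "mset ls = proots (char_poly T)"
    using assms(2) by (simp add: eigenvalue_listing_def)
  show "length ls = N"
    using arg_cong[OF ms, of size] deg by (simp add: size_proots_complex)
  have "char_poly T = (\<Prod>x\<in>#proots (char_poly T). [:- x, 1:])"
    using complex_poly_decompose_multiset[of "char_poly T"] lc by simp
  also have "\<dots> = (\<Prod>a\<leftarrow>ls. [:- a, 1:])"
    by (simp flip: ms prod_mset_prod_list)
  finally show "char_poly T = (\<Prod>a\<leftarrow>ls. [:- a, 1:])" .
qed

lemma Omega_eq:
  assumes T: "T \<in> carrier_mat N N" and ls: "eigenvalue_listing T ls"
  shows "\<Omega> k T = (\<Inter>S \<in> {S. S \<subseteq> {..<N} \<and> card S = N - k + 1}. convex hull ((\<lambda>j. ls ! j) ` S))"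
proof -
  define hs where "hs = (\<lambda>xs :: complex list.
    (\<lambda>S. convex hull ((\<lambda>j. xs ! j) ` S)) ` {S. S \<subseteq> {..<N} \<and> card S = N - k + 1})"
  have sub: "hs xs \<subseteq> hs ys"
    if len: "length xs = N" "length ys = N" and eq: "mset xs = mset ys" for xs ys
  proof
    fix C assume "C \<in> hs xs"
    then obtain S where S: "S \<subseteq> {..<N}" "card S = N - k + 1"
      and C: "C = convex hull ((\<lambda>j. xs ! j) ` S)"
      by (auto simp: hs_def)
    obtain p where p: "bij_betw p {..<N} {..<N}" "\<And>i. i < N \<Longrightarrow> xs ! i = ys ! p i"
      using permutation_Ex_bij[OF eq] len by auto
    have "p ` S \<subseteq> {..<N}" "card (p ` S) = N - k + 1"
      using S p(1) by (auto simp: bij_betw_def card_image inj_on_subset)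
    moreover have "(\<lambda>j. xs ! j) ` S = (\<lambda>j. ys ! j) ` (p ` S)"
      using S(1) p(2) by (force simp: image_image intro!: image_cong)
    ultimately show "C \<in> hs ys"
      unfolding hs_def C by (intro image_eqI[where x = "p ` S"]) auto
  qed
  define ls0 where "ls0 = (SOME ls. eigenvalue_listing T ls)"
  have ls0: "eigenvalue_listing T ls0"
    unfolding ls0_def by (rule someI_ex[OF eigenvalue_listing_exists])
  have "hs ls0 = hs ls"
    using sub[of ls ls0] sub[of ls0 ls] ls ls0
      eigenvalue_listing_char_poly(1)[OF T ls] eigenvalue_listing_char_poly(1)[OF T ls0]
    by (auto simp: eigenvalue_listing_def)
  moreover have "\<Omega> k T = \<Inter> (hs ls0)"
    using T by (simp add: Omega_def hs_def ls0_def Let_def)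
  ultimately show ?thesis
    by (simp add: hs_def)
qed

end

theory Submission
  imports Defs
begin

text \<open>After diagonalizing and translating, \<open>0 \<in> \<Lambda>\<^sub>k(diag g)\<close> means that some
  \<open>k\<close>-dimensional subspace is isotropic for the sesquilinear form of \<open>diag g\<close>, and
  \<open>0 \<in> \<Omega>\<^sub>k(diag g)\<close> means that \<open>0\<close> is a nontrivial nonnegative combination of any
  \<open>N - k + 1\<close> of the entries of \<open>g\<close>. Both conditions are unaffected by multiplying the entries by
  positive numbers, so nonzero entries can be normalized to modulus one, which gives a unitary
  operator. If \<open>g\<close> has \<open>m\<close> zero entries, they are removed together with \<open>m\<close> from \<open>k\<close>,
  which keeps \<open>N - k + 1\<close> fixed, and the kernel is added back to the isotropic subspace
  afterwards. The inclusion of \<open>\<Lambda>\<^sub>k\<close> in \<open>\<Omega>\<^sub>k\<close> holds for every normal operator, because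
  a \<open>k\<close>-dimensional subspace meets the span of any \<open>N - k + 1\<close> eigenvectors.\<close>

section \<open>Unitary diagonalization of normal matrices\<close>

lemma mult_cnj_eq: "z * cnj z = (complex_of_real (cmod z))\<^sup>2"
  by (metis complex_norm_square of_real_power)

lemma mat_adjoint_carrier [simp]:
  "A \<in> carrier_mat n m \<Longrightarrow> mat_adjoint A \<in> carrier_mat m n"
  unfolding mat_adjoint_def by (auto simp: mat_of_rows_def)

lemma dim_mat_adjoint [simp]:
  "dim_row (mat_adjoint A) = dim_col A" "dim_col (mat_adjoint A) = dim_row A"
  unfolding mat_adjoint_def by (auto simp: mat_of_rows_def)

lemma index_mat_adjoint [simp]:
  "i < dim_col A \<Longrightarrow> j < dim_row A \<Longrightarrow> mat_adjoint A $$ (i, j) = conjugate (A $$ (j, i))"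
  unfolding mat_adjoint_def by (simp add: mat_of_rows_index)

lemma mat_adjoint_adjoint [simp]: "mat_adjoint (mat_adjoint A) = A"
  by (rule eq_matI) auto

lemma index_mat_mult_sum:
  assumes "A \<in> carrier_mat n m" "B \<in> carrier_mat m p" "i < n" "j < p"
  shows "(A * B) $$ (i, j) = (\<Sum>l<m. A $$ (i, l) * B $$ (l, j))"
  using assms by (auto simp: scalar_prod_def lessThan_atLeast0)

lemma mat_adjoint_mult:
  fixes A B :: "complex mat"
  assumes A: "A \<in> carrier_mat n m" and B: "B \<in> carrier_mat m p"
  shows "mat_adjoint (A * B) = mat_adjoint B * mat_adjoint A"
proof (rule eq_matI)
  fix i j assume ij: "i < dim_row (mat_adjoint B * mat_adjoint A)"
    "j < dim_col (mat_adjoint B * mat_adjoint A)"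
  have "mat_adjoint (A * B) $$ (i, j) = cnj ((A * B) $$ (j, i))"
    using ij A B by simp
  also have "\<dots> = (\<Sum>l<m. cnj (A $$ (j, l)) * cnj (B $$ (l, i)))"
    using ij A B by (subst index_mat_mult_sum[OF A B]) auto
  also have "\<dots> = (mat_adjoint B * mat_adjoint A) $$ (i, j)"
    using ij A B
    by (subst index_mat_mult_sum[where n = p and m = m and p = n]) (auto intro!: sum.cong)
  finally show "mat_adjoint (A * B) $$ (i, j) = (mat_adjoint B * mat_adjoint A) $$ (i, j)" .
qed (use A B in auto)

lemma mat_adjoint_one [simp]: "mat_adjoint (1\<^sub>m n :: complex mat) = 1\<^sub>m n"
  by (rule eq_matI) auto

lemma mat_adjoint_mat_diag: "mat_adjoint (mat_diag n f) = mat_diag n (\<lambda>i. cnj (f i))"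
  by (rule eq_matI) (auto simp: mat_diag_def)

lemma mat_adjoint_four_block:
  fixes A B C D :: "complex mat"
  assumes "A \<in> carrier_mat n m" "B \<in> carrier_mat n m'" "C \<in> carrier_mat n' m" "D \<in> carrier_mat n' m'"
  shows "mat_adjoint (four_block_mat A B C D) =
    four_block_mat (mat_adjoint A) (mat_adjoint C) (mat_adjoint B) (mat_adjoint D)"
  using assms by (intro eq_matI) auto

lemma mult_block_diag:
  fixes A B C D :: "complex mat"
  assumes A: "A \<in> carrier_mat n n" and B: "B \<in> carrier_mat n n"
    and C: "C \<in> carrier_mat m m" and D: "D \<in> carrier_mat m m"
  shows "four_block_mat A (0\<^sub>m n m) (0\<^sub>m m n) C * four_block_mat B (0\<^sub>m n m) (0\<^sub>m m n) D =
    four_block_mat (A * B) (0\<^sub>m n m) (0\<^sub>m m n) (C * D)"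
proof -
  have "A * B \<in> carrier_mat n n" "C * D \<in> carrier_mat m m"
    using assms by auto
  then show ?thesis
    using assms by (subst mult_four_block_mat[of A n n _ m _ m _ _ n _ m]) auto
qed

lemma unitary_opI:
  assumes "W \<in> carrier_mat n n" "mat_adjoint W * W = 1\<^sub>m n"
  shows "unitary_op n W"
  using assms mat_mult_left_right_inverse[of "mat_adjoint W" n W] by (auto simp: unitary_op_def)

lemma unitary_op_mult:
  assumes "unitary_op n V" "unitary_op n W"
  shows "unitary_op n (V * W)"
proof (rule unitary_opI)
  have c: "V \<in> carrier_mat n n" "W \<in> carrier_mat n n"
    "mat_adjoint V \<in> carrier_mat n n" "mat_adjoint W \<in> carrier_mat n n"
    using assms by (auto simp: unitary_op_def)
  show "V * W \<in> carrier_mat n n"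
    using c by auto
  have "mat_adjoint V * (V * W) = W"
    using assms c by (simp add: unitary_op_def flip: assoc_mult_mat[of _ n n _ n _ n])
  then show "mat_adjoint (V * W) * (V * W) = 1\<^sub>m n"
    using assms c by (simp add: unitary_op_def mat_adjoint_mult[of V n n] assoc_mult_mat[of _ n n _ n _ n])
qed

lemma normal_op_unitary_conj:
  assumes A: "normal_op n A" and W: "unitary_op n W"
  shows "normal_op n (mat_adjoint W * A * W)"
proof -
  have c: "A \<in> carrier_mat n n" "W \<in> carrier_mat n n"
    "mat_adjoint A \<in> carrier_mat n n" "mat_adjoint W \<in> carrier_mat n n"
    using assms by (auto simp: unitary_op_def normal_op_def)
  \<comment> \<open>Unitarity and normality are stated with a trailing factor \<open>X\<close> so
    that they rewrite inside right-nested products.\<close>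
  have WW: "W * (mat_adjoint W * X) = X" if "X \<in> carrier_mat n n" for X
    using W that c by (simp add: unitary_op_def flip: assoc_mult_mat[of _ n n _ n _ n])
  have AA: "mat_adjoint A * (A * X) = A * (mat_adjoint A * X)" if "X \<in> carrier_mat n n" for X
    using A that c by (simp add: normal_op_def flip: assoc_mult_mat[of _ n n _ n _ n])
  have adj: "mat_adjoint (mat_adjoint W * A * W) = mat_adjoint W * (mat_adjoint A * W)"
    using c by (simp add: mat_adjoint_mult[of _ n n _ n] mult_carrier_mat[of _ n n _ n]
        assoc_mult_mat[of _ n n _ n _ n])
  show ?thesis
    unfolding normal_op_def adj
    using c by (simp add: mult_carrier_mat[of _ n n _ n] assoc_mult_mat[of _ n n _ n _ n] WW AA)
qed

lemma char_poly_unitary_conj: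
  assumes A: "A \<in> carrier_mat n n" and W: "unitary_op n W"
  shows "char_poly (mat_adjoint W * A * W) = char_poly A"
proof (rule char_poly_similar)
  show "similar_mat (mat_adjoint W * A * W) A"
    using assms
    by (intro similar_matI[where P = "mat_adjoint W" and Q = W and n = n])
       (auto simp: unitary_op_def)
qed

text \<open>Gram-Schmidt applied to a basis starting with \<open>v\<close> leaves \<open>v\<close>
  in first place; dividing each vector by its norm gives the columns of \<open>W\<close>, so
  \<open>c\<close> is the reciprocal of the norm of \<open>v\<close>.\<close>

lemma unitary_completion:
  fixes v :: "complex vec"
  assumes v: "v \<in> carrier_vec n" and v0: "v \<noteq> 0\<^sub>v n"
  obtains W c where "unitary_op n W" "0 < n" "col W 0 = c \<cdot>\<^sub>v v"
proof -
  interpret cof_vec_space n "TYPE(complex)" .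
  define ws where "ws = gram_schmidt n (basis_completion v)"
  note b = basis_completion[OF v v0]
  have n: "0 < n"
    using v v0 by (cases n) auto
  obtain vs where bv: "basis_completion v = v # vs"
    using b(6,7) n by (cases "basis_completion v") auto
  have ws: "corthogonal ws" "set ws \<subseteq> carrier_vec n" "length ws = n"
    using gram_schmidt_result[OF b(2,4,5) ws_def] b(6) by auto
  have "hd ws = v"
    unfolding ws_def bv using v by (rule gram_schmidt_hd)
  then have ws0: "ws ! 0 = v"
    using ws(3) n by (cases ws) auto
  have wsc: "ws ! j \<in> carrier_vec n" if "j < n" for j
    using that ws(2,3) by (auto dest: nth_mem)
  define nrm where "nrm j = (\<Sum>l<n. (cmod (ws ! j $ l))\<^sup>2)" for j
  define r where "r j = complex_of_real (1 / sqrt (nrm j))" for j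
  have ip: "(\<Sum>l<n. cnj (ws ! i $ l) * ws ! j $ l) = (if i = j then complex_of_real (nrm i) else 0)"
    if "i < n" "j < n" for i j
  proof -
    have "ws ! j \<bullet>c ws ! i = (\<Sum>l<n. cnj (ws ! i $ l) * ws ! j $ l)"
      using wsc[OF that(1)] by (simp add: scalar_prod_def lessThan_atLeast0 mult.commute)
    then show ?thesis
      using corthogonalD[OF ws(1), of j i] that ws(3)
      by (auto simp: nrm_def mult_cnj_eq mult.commute[of "cnj _"])
  qed
  have nrm_pos: "0 < nrm j" if "j < n" for j
  proof -
    have "ws ! j \<bullet>c ws ! j = (\<Sum>l<n. cnj (ws ! j $ l) * ws ! j $ l)"
      using wsc[OF that] by (simp add: scalar_prod_def lessThan_atLeast0 mult.commute)
    then have "nrm j \<noteq> 0"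
      using corthogonalD[OF ws(1), of j j] that ws(3) ip[of j j] by auto
    then show ?thesis
      using sum_nonneg[of "{..<n}" "\<lambda>l. (cmod (ws ! j $ l))\<^sup>2"] by (simp add: nrm_def)
  qed
  define W where "W = mat n n (\<lambda>(i, j). r j * ws ! j $ i)"
  have W: "W \<in> carrier_mat n n"
    by (simp add: W_def)
  have "unitary_op n W"
  proof (rule unitary_opI[OF W], rule eq_matI)
    fix i j assume "i < dim_row (1\<^sub>m n :: complex mat)" "j < dim_col (1\<^sub>m n :: complex mat)"
    then have ij: "i < n" "j < n" by auto
    have "(mat_adjoint W * W) $$ (i, j) =
        (\<Sum>l<n. cnj (r i) * r j * (cnj (ws ! i $ l) * ws ! j $ l))"
      using ij W by (subst index_mat_mult_sum[where n = n and m = n and p = n])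
        (auto simp: W_def intro!: sum.cong)
    also have "\<dots> = cnj (r i) * r j * (if i = j then complex_of_real (nrm i) else 0)"
      by (simp only: ip[OF ij] flip: sum_distrib_left)
    also have "\<dots> = 1\<^sub>m n $$ (i, j)"
    proof (cases "i = j")
      case True
      have "1 / sqrt (nrm j) * (1 / sqrt (nrm j)) * nrm j = 1"
        using nrm_pos[OF ij(2)] by (simp add: field_simps)
      then show ?thesis
        using True ij by (simp add: r_def flip: of_real_mult)
    qed (use ij in simp)
    finally show "(mat_adjoint W * W) $$ (i, j) = 1\<^sub>m n $$ (i, j)" .
  qed (use W in auto)
  moreover have "col W 0 = r 0 \<cdot>\<^sub>v v"
    using n v ws0 by (intro eq_vecI) (auto simp: W_def)
  ultimately show ?thesis
    using that n by blast
qed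

text \<open>The (0,0) entries of the two products in the normality equation are the squared norms of
  the first column and of the first row. The column contributes only its diagonal entry, so nothing
  is left for the rest of the row.\<close>

lemma normal_op_row_zero:
  assumes A: "normal_op (Suc m) A"
    and col: "\<And>i. i < m \<Longrightarrow> A $$ (Suc i, 0) = 0"
    and j: "j < m"
  shows "A $$ (0, Suc j) = 0"
proof -
  have c: "A \<in> carrier_mat (Suc m) (Suc m)" and AA: "mat_adjoint A * A = A * mat_adjoint A"
    using A by (auto simp: normal_op_def)
  have "(mat_adjoint A * A) $$ (0, 0) = (\<Sum>l<Suc m. cnj (A $$ (l, 0)) * A $$ (l, 0))"
    using c by (subst index_mat_mult_sum[where n = "Suc m" and m = "Suc m" and p = "Suc m"])
      (auto intro!: sum.cong)
  also have "\<dots> = cnj (A $$ (0, 0)) * A $$ (0, 0)"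
    unfolding sum.lessThan_Suc_shift using col by simp
  finally have 1: "(mat_adjoint A * A) $$ (0, 0) = complex_of_real ((cmod (A $$ (0, 0)))\<^sup>2)"
    by (simp add: mult_cnj_eq mult.commute[of "cnj _"])
  have "(A * mat_adjoint A) $$ (0, 0) = (\<Sum>l<Suc m. A $$ (0, l) * cnj (A $$ (0, l)))"
    using c by (subst index_mat_mult_sum[where n = "Suc m" and m = "Suc m" and p = "Suc m"])
      (auto intro!: sum.cong)
  also have "\<dots> = complex_of_real (\<Sum>l<Suc m. (cmod (A $$ (0, l)))\<^sup>2)"
    by (simp add: mult_cnj_eq)
  finally have "(\<Sum>l<Suc m. (cmod (A $$ (0, l)))\<^sup>2) = (cmod (A $$ (0, 0)))\<^sup>2"
    using 1 AA by (metis of_real_eq_iff)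
  then have "(\<Sum>l<m. (cmod (A $$ (0, Suc l)))\<^sup>2) = 0"
    unfolding sum.lessThan_Suc_shift by simp
  then show ?thesis
    using j by (subst (asm) sum_nonneg_eq_0_iff) auto
qed

text \<open>Induction on the list of eigenvalues: a unitary whose first column is an eigenvector for
  the head splits off a 1 by 1 block, and normality clears the first row as well. The diagonal
  appears in the order of \<open>es\<close>, so every ordering of the eigenvalues can be
  realized.\<close>

theorem normal_op_diagonalization:
  assumes "normal_op n A" and "char_poly A = (\<Prod>a\<leftarrow>es. [:- a, 1:])"
  shows "\<exists>W. unitary_op n W \<and> mat_adjoint W * A * W = mat_diag n (\<lambda>i. es ! i)"
  using assms
proof (induction es arbitrary: n A)
  case Nil
  then have "n = 0"
    using degree_monic_char_poly[of A n] by (auto simp: normal_op_def)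
  then have "unitary_op n (1\<^sub>m n)" "mat_adjoint (1\<^sub>m n) * A * 1\<^sub>m n = mat_diag n (\<lambda>i. [] ! i)"
    using Nil.prems(1) by (auto simp: unitary_op_def normal_op_def mat_diag_def intro!: eq_matI)
  then show ?case by blast
next
  case (Cons e es)
  have A: "A \<in> carrier_mat n n"
    using Cons.prems(1) by (auto simp: normal_op_def)
  have "eigenvalue A e"
    unfolding eigenvalue_root_char_poly[OF A] Cons.prems(2) by simp
  then obtain v where v: "v \<in> carrier_vec n" "v \<noteq> 0\<^sub>v n" "A *\<^sub>v v = e \<cdot>\<^sub>v v"
    using A by (auto simp: eigenvalue_def eigenvector_def)
  obtain W c where W: "unitary_op n W" and n: "0 < n" and col: "col W 0 = c \<cdot>\<^sub>v v"
    using unitary_completion[OF v(1,2)] .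
  then obtain m where m: "n = Suc m"
    using gr0_conv_Suc by auto
  have Wc: "W \<in> carrier_mat n n" "mat_adjoint W \<in> carrier_mat n n"
    using W by (auto simp: unitary_op_def)
  define B where "B = mat_adjoint W * A * W"
  have B: "B \<in> carrier_mat n n"
    unfolding B_def using Wc A by auto
  have nB: "normal_op n B"
    unfolding B_def by (rule normal_op_unitary_conj[OF Cons.prems(1) W])
  have AW: "A *\<^sub>v col W 0 = e \<cdot>\<^sub>v col W 0"
    using v A by (auto simp: col mult_mat_vec smult_smult_assoc mult.commute)
  \<comment> \<open>The first column of \<open>W\<close> is an eigenvector, and its image under the
    adjoint of \<open>W\<close> is the first unit vector; hence the first column of \<open>B\<close>
    is \<open>e\<close> times that vector.\<close>
  have "col B 0 = mat_adjoint W *\<^sub>v (A *\<^sub>v col W 0)"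
  proof -
    have "col (A * W) 0 = A *\<^sub>v col W 0"
      using A Wc n by (intro col_mult2) auto
    moreover have "col (mat_adjoint W * (A * W)) 0 = mat_adjoint W *\<^sub>v col (A * W) 0"
      using A Wc n by (intro col_mult2) auto
    ultimately show ?thesis
      unfolding B_def using A Wc by (simp add: assoc_mult_mat[of _ n n _ n _ n])
  qed
  also have "\<dots> = e \<cdot>\<^sub>v col (mat_adjoint W * W) 0"
    unfolding AW using Wc n by (auto simp: mult_mat_vec[of _ n n] col_mult2)
  also have "\<dots> = e \<cdot>\<^sub>v unit_vec n 0"
    using W n by (simp add: unitary_op_def)
  finally have colB: "col B 0 = e \<cdot>\<^sub>v unit_vec n 0" .
  have B_col: "B $$ (i, 0) = (if i = 0 then e else 0)" if "i < n" for i
    using arg_cong[OF colB, of "\<lambda>v. v $ i"] that B n by (auto simp: unit_vec_def)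
  have B_row: "B $$ (0, Suc j) = 0" if "j < m" for j
    using normal_op_row_zero[of m B j] nB B_col that by (auto simp: m)
  define C where "C = mat m m (\<lambda>(i, j). B $$ (Suc i, Suc j))"
  define E where "E = mat 1 1 (\<lambda>_. e)"
  have C: "C \<in> carrier_mat m m" and E: "E \<in> carrier_mat 1 1"
    by (auto simp: C_def E_def)
  have block: "B = four_block_mat E (0\<^sub>m 1 m) (0\<^sub>m m 1) C"
  proof (rule eq_matI)
    fix i j assume ij: "i < dim_row (four_block_mat E (0\<^sub>m 1 m) (0\<^sub>m m 1) C)"
      "j < dim_col (four_block_mat E (0\<^sub>m 1 m) (0\<^sub>m m 1) C)"
    then show "B $$ (i, j) = four_block_mat E (0\<^sub>m 1 m) (0\<^sub>m m 1) C $$ (i, j)"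
      using B_col[of i] B_row[of "j - 1"] C E m by (auto simp: C_def E_def)
  qed (use B C E m in auto)
  have adj0: "mat_adjoint (0\<^sub>m k l :: complex mat) = 0\<^sub>m l k" for k l
    by (rule eq_matI) auto
  \<comment> \<open>Both products are block diagonal, so normality of \<open>B\<close> passes to
    \<open>C\<close> by comparing the lower right blocks.\<close>
  have BB: "mat_adjoint B * B = four_block_mat (mat_adjoint E * E) (0\<^sub>m 1 m) (0\<^sub>m m 1) (mat_adjoint C * C)"
      "B * mat_adjoint B = four_block_mat (E * mat_adjoint E) (0\<^sub>m 1 m) (0\<^sub>m m 1) (C * mat_adjoint C)"
    unfolding block using E C
    by (simp_all only: mat_adjoint_four_block[of _ 1 1 _ m _ m] adj0 mult_block_diag
        mat_adjoint_carrier zero_carrier_mat)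
  have "normal_op m C"
    unfolding normal_op_def
  proof (intro conjI C eq_matI)
    fix i j assume "i < dim_row (C * mat_adjoint C)" "j < dim_col (C * mat_adjoint C)"
    then show "(mat_adjoint C * C) $$ (i, j) = (C * mat_adjoint C) $$ (i, j)"
      using arg_cong[of _ _ "\<lambda>M. M $$ (Suc i, Suc j)", OF BB(1)]
        arg_cong[of _ _ "\<lambda>M. M $$ (Suc i, Suc j)", OF BB(2)] nB E C
      by (simp add: normal_op_def)
  qed (use C in auto)
  have "char_poly B = char_poly E * char_poly C"
    unfolding block by (rule char_poly_four_block_zeros_col) (use E C in auto)
  moreover have "char_poly E = [:- e, 1:]"
    by (simp add: E_def char_poly_defs det_def sign_def)
  ultimately have "[:- e, 1:] * char_poly C = [:- e, 1:] * (\<Prod>a\<leftarrow>es. [:- a, 1:])"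
    using Cons.prems(2) char_poly_unitary_conj[OF A W] by (simp add: B_def)
  then have "char_poly C = (\<Prod>a\<leftarrow>es. [:- a, 1:])"
    by (metis mult_cancel_left pCons_eq_0_iff zero_neq_one)
  then obtain V where V: "unitary_op m V" "mat_adjoint V * C * V = mat_diag m (\<lambda>i. es ! i)"
    using Cons.IH \<open>normal_op m C\<close> by blast
  have Vc: "V \<in> carrier_mat m m" "mat_adjoint V \<in> carrier_mat m m"
    using V by (auto simp: unitary_op_def)
  \<comment> \<open>The unitary that diagonalizes the smaller block is extended by 1 in the corner;
    \<open>W * X\<close> then diagonalizes \<open>A\<close>.\<close>
  define X where "X = four_block_mat (1\<^sub>m 1) (0\<^sub>m 1 m) (0\<^sub>m m 1) V"
  have adjX: "mat_adjoint X = four_block_mat (1\<^sub>m 1) (0\<^sub>m 1 m) (0\<^sub>m m 1) (mat_adjoint V)"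
    unfolding X_def using Vc by (simp add: mat_adjoint_four_block[of _ 1 1 _ m _ m] adj0)
  have Xc: "X \<in> carrier_mat n n"
    unfolding X_def m using Vc four_block_carrier_mat[of "1\<^sub>m 1" 1 1 V m m] by simp
  have "unitary_op n X"
  proof (rule unitary_opI[OF Xc])
    show "mat_adjoint X * X = 1\<^sub>m n"
      unfolding adjX unfolding X_def using Vc V(1)
      by (simp add: mult_block_diag unitary_op_def four_block_one_mat m)
  qed
  moreover have "mat_adjoint X * B * X = mat_diag n (\<lambda>i. (e # es) ! i)"
  proof -
    have "mat_adjoint X * B * X =
        four_block_mat E (0\<^sub>m 1 m) (0\<^sub>m m 1) (mat_diag m (\<lambda>i. es ! i))"
      unfolding adjX block unfolding X_def using Vc E C
      by (simp add: mult_block_diag mult_carrier_mat[of _ m m _ m] V(2))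
    also have "\<dots> = mat_diag n (\<lambda>i. (e # es) ! i)"
      by (rule eq_matI) (auto simp: m mat_diag_def E_def nth_Cons')
    finally show ?thesis .
  qed
  moreover have "mat_adjoint (W * X) * A * (W * X) = mat_adjoint X * B * X"
    unfolding B_def using Wc Xc A
    by (simp add: mat_adjoint_mult[of W n n] mult_carrier_mat[of _ n n _ n]
        assoc_mult_mat[of _ n n _ n _ n])
  ultimately show ?case
    using unitary_op_mult[OF W] by (intro exI[of _ "W * X"]) simp
qed

section \<open>Compressions to subspaces of rank k\<close>

text \<open>Encodes a \<open>k\<close>-dimensional subspace by a basis, the columns of
  \<open>X\<close>, which need not be orthonormal.\<close>

definition full_col_rank :: "nat \<Rightarrow> nat \<Rightarrow> complex mat \<Rightarrow> bool" where
  "full_col_rank n k X \<longleftrightarrow> X \<in> carrier_mat n k \<and>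
     (\<forall>c \<in> carrier_vec k. X *\<^sub>v c = 0\<^sub>v n \<longrightarrow> c = 0\<^sub>v k)"

text \<open>The rank is the size of a maximal independent set of columns of \<open>P\<close>. These
  columns form \<open>X\<close>, and \<open>P\<close> fixes them because it is idempotent.\<close>

lemma orth_projection_range_basis:
  assumes P: "orth_projection n P" and rank: "vec_space.rank n P = k"
  obtains X where "full_col_rank n k X" "P * X = X"
proof -
  interpret vec_space "TYPE(complex)" n .
  have Pc: "P \<in> carrier_mat n n" and PP: "P * P = P"
    using P by (auto simp: orth_projection_def)
  obtain S where S: "maximal S (\<lambda>T. T \<subseteq> set (cols P) \<and> lin_indpt T)"
    using maximal_exists_superset[of "set (cols P)" "\<lambda>T. T \<subseteq> set (cols P) \<and> lin_indpt T" "{}"]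
    by (auto simp: lin_dep_def)
  then have sub: "S \<subseteq> set (cols P)" and indep: "lin_indpt S"
    by (auto simp: maximal_def)
  have cardS: "card S = k"
    using rank_card_indpt[OF Pc S] rank by simp
  obtain xs where xs: "set xs = S" "distinct xs"
    using finite_distinct_list[of S] finite_subset[OF sub] by auto
  have len: "length xs = k"
    using xs cardS distinct_card by fastforce
  have Sc: "S \<subseteq> carrier_vec n"
    using sub cols_dim[of P] Pc by auto
  define X where "X = mat_of_cols n xs"
  have Xc: "X \<in> carrier_mat n k"
    unfolding X_def using len by auto
  have colsX: "cols X = xs"
    unfolding X_def using Sc xs by (intro cols_mat_of_cols) auto
  have "full_col_rank n k X"
    unfolding full_col_rank_def
  proof (intro conjI Xc ballI impI)
    fix c assume "c \<in> carrier_vec k" "X *\<^sub>v c = 0\<^sub>v n"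
    then show "c = 0\<^sub>v k"
      using lin_depI[OF Xc, of c] indep xs colsX by auto
  qed
  moreover have "P * X = X"
  proof (rule mat_col_eqI)
    fix j assume j: "j < dim_col X"
    then have "col X j \<in> set (cols P)"
      using colsX xs sub by (metis cols_length cols_nth nth_mem subsetD)
    then obtain i where i: "i < n" "col X j = col P i"
      using Pc by (auto simp: cols_def)
    have "col (P * X) j = P *\<^sub>v col P i"
      using Pc Xc j i by (subst col_mult2[of _ n n _ k]) auto
    also have "\<dots> = col (P * P) i"
      using Pc i by (subst col_mult2[of _ n n _ n]) auto
    finally show "col (P * X) j = col X j"
      using PP i by simp
  qed (use Pc Xc in auto)
  ultimately show ?thesis
    using that by blast
qed

text \<open>If the Gram matrix kills \<open>c\<close>, then \<open>X *\<^sub>v c\<close> has squared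
  norm zero, so \<open>c\<close> is zero by full column rank. The inverse of a self-adjoint matrix
  is again self-adjoint.\<close>

lemma full_col_rank_gram_inverse:
  assumes X: "full_col_rank n k X"
  obtains G where "G \<in> carrier_mat k k" "G * (mat_adjoint X * X) = 1\<^sub>m k" "mat_adjoint G = G"
proof -
  have Xc: "X \<in> carrier_mat n k" "mat_adjoint X \<in> carrier_mat k n"
    using X by (auto simp: full_col_rank_def)
  define H where "H = mat_adjoint X * X"
  have H: "H \<in> carrier_mat k k" and adjH: "mat_adjoint H = H"
    unfolding H_def using Xc by (auto simp: mat_adjoint_mult[of _ k n])
  have "det H \<noteq> 0"
  proof
    assume "det H = 0"
    then obtain c where c: "c \<in> carrier_vec k" "c \<noteq> 0\<^sub>v k" "H *\<^sub>v c = 0\<^sub>v k"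
      using det_0_iff_vec_prod_zero[OF H] by auto
    define w where "w = X *\<^sub>v c"
    define C where "C = mat_of_cols k [c]"
    have w: "w \<in> carrier_vec n"
      unfolding w_def using Xc c by auto
    have "mat_adjoint X *\<^sub>v w = 0\<^sub>v k"
      unfolding w_def using c Xc by (simp add: H_def assoc_mult_mat_vec[of _ k n _ k])
    \<comment> \<open>This is the inner product of \<open>c\<close> with the adjoint of
      \<open>X\<close> applied to \<open>w\<close>; moving \<open>X\<close> to the other side turns
      it into the squared norm of \<open>w\<close>.\<close>
    then have "(\<Sum>a<k. cnj (c $ a) * (\<Sum>i<n. cnj (X $$ (i, a)) * w $ i)) = 0"
    proof -
      have "(\<Sum>i<n. cnj (X $$ (i, a)) * w $ i) = (mat_adjoint X *\<^sub>v w) $ a" if "a < k" for a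
        using that Xc w by (auto simp: scalar_prod_def lessThan_atLeast0 intro!: sum.cong)
      then show ?thesis
        using \<open>mat_adjoint X *\<^sub>v w = 0\<^sub>v k\<close> by simp
    qed
    moreover have "cnj (w $ i) = (\<Sum>a<k. cnj (c $ a) * cnj (X $$ (i, a)))" if "i < n" for i
      using that Xc c unfolding w_def
      by (auto simp: scalar_prod_def lessThan_atLeast0 mult.commute intro!: sum.cong)
    then have "(\<Sum>i<n. cnj (w $ i) * w $ i) =
        (\<Sum>i<n. \<Sum>a<k. cnj (c $ a) * (cnj (X $$ (i, a)) * w $ i))"
      by (intro sum.cong) (auto simp: sum_distrib_right mult.assoc)
    then have "(\<Sum>i<n. cnj (w $ i) * w $ i) =
        (\<Sum>a<k. cnj (c $ a) * (\<Sum>i<n. cnj (X $$ (i, a)) * w $ i))"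
      by (subst (asm) sum.swap) (simp add: sum_distrib_left)
    ultimately have "complex_of_real (\<Sum>i<n. (cmod (w $ i))\<^sup>2) = 0"
      by (simp add: mult_cnj_eq mult.commute[of "cnj _"])
    then have "(\<Sum>i<n. (cmod (w $ i))\<^sup>2) = 0"
      unfolding of_real_eq_0_iff .
    then have "w = 0\<^sub>v n"
      using w by (intro eq_vecI) (auto simp: sum_nonneg_eq_0_iff)
    then show False
      using X c by (auto simp: full_col_rank_def w_def)
  qed
  then obtain G where G: "G \<in> carrier_mat k k" "G * H = 1\<^sub>m k" "H * G = 1\<^sub>m k"
    using det_non_zero_imp_unit[OF H, of "()"] by (auto simp: Units_def ring_mat_def)
  have "mat_adjoint G = mat_adjoint G * (H * G)"
    using G by simp
  also have "\<dots> = mat_adjoint (H * G) * G"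
    using G(1) H by (simp add: mat_adjoint_mult[of H k k] adjH assoc_mult_mat[of _ k k _ k _ k])
  finally have "mat_adjoint G = G"
    using G by simp
  then show ?thesis
    using that G by (simp add: H_def)
qed

text \<open>With only dimension equations as premises, the simplifier can reassociate products of
  rectangular matrices.\<close>

lemma assoc_mult_mat_dim:
  fixes A B C :: "'a :: semiring_0 mat"
  assumes "dim_col A = dim_row B" "dim_col B = dim_row C"
  shows "A * B * C = A * (B * C)"
  using assms by (intro assoc_mult_mat[of _ "dim_row A" "dim_col A" _ "dim_col B" _ "dim_col C"]) auto

text \<open>Each matrix factors through the other, so the column spaces coincide, and they determine
  the rank.\<close>

lemma rank_eq_if_col_space_eq:
  assumes "X \<in> carrier_mat n k" "Y \<in> carrier_mat n l" "A \<in> carrier_mat k l" "B \<in> carrier_mat l k"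
    and "Y = X * A" "X = Y * (B :: complex mat)"
  shows "vec_space.rank n X = vec_space.rank n Y"
proof -
  interpret vec_space "TYPE(complex)" n .
  have "col_space (U * C) \<subseteq> col_space U"
    if U: "U \<in> carrier_mat n p" and C: "C \<in> carrier_mat p q" for U C p q
  proof
    fix y assume "y \<in> col_space (U * C)"
    then obtain x where x: "x \<in> carrier_vec q" "y = U *\<^sub>v (C *\<^sub>v x)"
      using U C by (auto simp: col_space_eq[of _ q])
    then show "y \<in> col_space U"
      using U C by (auto simp: col_space_eq[of _ p] intro!: bexI[of _ "C *\<^sub>v x"])
  qed
  from this[OF assms(1,3), folded assms(5)] this[OF assms(2,4), folded assms(6)]
  have "col_space X = col_space Y"
    by (rule equalityI[rotated])
  then show ?thesis
    by (simp add: rank_def col_space_def)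
qed

lemma rank_full_col_rank:
  assumes X: "full_col_rank n k X"
  shows "vec_space.rank n X = k"
proof -
  interpret vec_space "TYPE(complex)" n .
  have Xc: "X \<in> carrier_mat n k"
    using X by (simp add: full_col_rank_def)
  \<comment> \<open>Linear independence is a property of the set of columns, so repetitions are
    excluded first: two equal columns would put a difference of unit vectors into the
    kernel.\<close>
  have dist: "distinct (cols X)"
    unfolding distinct_conv_nth
  proof (intro allI impI)
    fix i j assume "i < length (cols X)" "j < length (cols X)" "i \<noteq> j"
    then have ij: "i < k" "j < k" "i \<noteq> j" using Xc by auto
    show "cols X ! i \<noteq> cols X ! j"
    proof
      assume eq: "cols X ! i = cols X ! j"
      have "X *\<^sub>v (unit_vec k i - unit_vec k j) = col X i - col X j"
      proof -
        have "X *\<^sub>v unit_vec k l = col X l" if "l < k" for l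
          using that Xc by (intro eq_vecI) auto
        then show ?thesis
          using ij Xc by (subst mult_minus_distrib_mat_vec[of _ n k]) auto
      qed
      also have "\<dots> = 0\<^sub>v n"
        using eq ij Xc by auto
      finally have "unit_vec k i - unit_vec k j = (0\<^sub>v k :: complex vec)"
        using X by (simp add: full_col_rank_def)
      then have "(unit_vec k i - unit_vec k j) $ i = (0\<^sub>v k :: complex vec) $ i"
        by simp
      then show False
        using ij by simp
    qed
  qed
  have "lin_indpt (set (cols X))"
    using lin_depE[OF Xc _ dist] X by (auto simp: full_col_rank_def)
  then show ?thesis
    by (rule lin_indpt_full_rank[OF Xc dist])
qed

text \<open>Exchanges a projection for an arbitrary basis of its range, which avoids
  orthonormalization: the scalar compression condition becomes an identity involving the Gram
  matrix.\<close>

lemma higher_rank_range_iff: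
  assumes T: "T \<in> carrier_mat n n"
  shows "z \<in> \<Lambda> k T \<longleftrightarrow>
    (\<exists>X. full_col_rank n k X \<and> mat_adjoint X * T * X = z \<cdot>\<^sub>m (mat_adjoint X * X))"
proof
  assume "z \<in> \<Lambda> k T"
  then obtain P where P: "orth_projection n P" "vec_space.rank n P = k" "P * T * P = z \<cdot>\<^sub>m P"
    using T by (auto simp: higher_rank_range_def)
  obtain X where X: "full_col_rank n k X" "P * X = X"
    using orth_projection_range_basis[OF P(1,2)] .
  have c: "P \<in> carrier_mat n n" "X \<in> carrier_mat n k" "mat_adjoint X \<in> carrier_mat k n"
    using P X by (auto simp: orth_projection_def full_col_rank_def)
  have adj: "mat_adjoint X * P = mat_adjoint X"
    using mat_adjoint_mult[of P n n X k] P(1) X(2) c by (simp add: orth_projection_def)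
  have "mat_adjoint X * T * X = (mat_adjoint X * P) * T * (P * X)"
    by (simp only: adj X(2))
  also have "\<dots> = mat_adjoint X * (P * T * P) * X"
    using c T by (simp add: assoc_mult_mat_dim)
  also have "\<dots> = z \<cdot>\<^sub>m (mat_adjoint X * P * X)"
    using c by (simp add: P(3) adj mult_smult_distrib[of _ k n _ n] mult_smult_assoc_mat[of _ k n _ k])
  finally show "\<exists>X. full_col_rank n k X \<and> mat_adjoint X * T * X = z \<cdot>\<^sub>m (mat_adjoint X * X)"
    using X adj by auto
next
  assume "\<exists>X. full_col_rank n k X \<and> mat_adjoint X * T * X = z \<cdot>\<^sub>m (mat_adjoint X * X)"
  then obtain X where X: "full_col_rank n k X" "mat_adjoint X * T * X = z \<cdot>\<^sub>m (mat_adjoint X * X)"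
    by blast
  obtain G where G: "G \<in> carrier_mat k k" "G * (mat_adjoint X * X) = 1\<^sub>m k" "mat_adjoint G = G"
    using full_col_rank_gram_inverse[OF X(1)] .
  define Y where "Y = mat_adjoint X"
  have c: "X \<in> carrier_mat n k" "Y \<in> carrier_mat k n"
    using X by (auto simp: full_col_rank_def Y_def)
  \<comment> \<open>With \<open>G\<close> the inverse Gram matrix, this is the standard formula for
    the orthogonal projection onto the column space of \<open>X\<close>.\<close>
  define P where "P = X * (G * Y)"
  have Pc: "P \<in> carrier_mat n n"
    unfolding P_def using c G by auto
  have GYX: "G * (Y * X) = 1\<^sub>m k"
    using G(2) by (simp add: Y_def)
  have PX: "P * X = X"
    unfolding P_def using c G(1) GYX by (simp add: assoc_mult_mat_dim)
  have "P * P = (P * X) * (G * Y)"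
    unfolding P_def using c G(1) by (simp add: assoc_mult_mat_dim)
  then have PP: "P * P = P"
    by (simp add: PX) (simp add: P_def)
  have "mat_adjoint P = P"
    unfolding P_def using c G by (simp add: mat_adjoint_mult[of _ n k _ n] mat_adjoint_mult[of _ k k _ n]
        mult_carrier_mat[of _ k k _ n] assoc_mult_mat_dim Y_def)
  with Pc PP have "orth_projection n P"
    by (simp add: orth_projection_def)
  moreover have "vec_space.rank n P = k"
  proof -
    have "G * Y \<in> carrier_mat k n"
      using G(1) c by auto
    from rank_eq_if_col_space_eq[OF c(1) Pc this c(1) P_def PX[symmetric]]
    show ?thesis
      using rank_full_col_rank[OF X(1)] by simp
  qed
  moreover have "P * T * P = z \<cdot>\<^sub>m P"
  proof -
    have "P * T * P = X * (G * ((Y * T * X) * (G * Y)))"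
      unfolding P_def using c G(1) T by (simp add: assoc_mult_mat_dim)
    also have "\<dots> = z \<cdot>\<^sub>m (X * (G * ((Y * X) * (G * Y))))"
      unfolding Y_def[symmetric] X(2)[folded Y_def] using c G(1)
      by (simp add: mult_smult_assoc_mat[of _ k k _ n] mult_smult_distrib[of _ k k _ n]
          mult_smult_distrib[of _ n k _ n] mult_carrier_mat[of _ k k _ n] mult_carrier_mat[of _ k n _ k])
    also have "X * (G * ((Y * X) * (G * Y))) = P * X * (G * Y)"
      unfolding P_def using c G(1) by (simp add: assoc_mult_mat_dim)
    finally show ?thesis
      by (simp only: PX flip: P_def)
  qed
  ultimately show "z \<in> \<Lambda> k T"
    using T by (auto simp: higher_rank_range_def)
qed

section \<open>Isotropic subspaces and balanced eigenvalues\<close>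

text \<open>The columns of the \<open>N \<times> k\<close> matrix \<open>x\<close> span a \<open>k\<close>-dimensional subspace on which
  the sesquilinear form of \<open>diag g\<close> vanishes; they are not required to be orthonormal, which makes
  the notion invariant under positive rescaling of \<open>g\<close>.\<close>

definition isotropic :: "nat \<Rightarrow> nat \<Rightarrow> (nat \<Rightarrow> complex) \<Rightarrow> bool" where
  "isotropic N k g \<longleftrightarrow> (\<exists>x :: nat \<Rightarrow> nat \<Rightarrow> complex.
     (\<forall>c. (\<forall>i<N. (\<Sum>a<k. x i a * c a) = 0) \<longrightarrow> (\<forall>a<k. c a = 0)) \<and>
     (\<forall>a<k. \<forall>b<k. (\<Sum>i<N. g i * (cnj (x i a) * x i b)) = 0))"

text \<open>Says that 0 is a convex combination of the values of \<open>g\<close> on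
  \<open>S\<close>, with the total weight only required to be positive instead of 1. This form
  survives positive rescaling of \<open>g\<close>, and weights on indices accommodate repeated
  eigenvalues.\<close>

definition balanced :: "nat set \<Rightarrow> (nat \<Rightarrow> complex) \<Rightarrow> bool" where
  "balanced S g \<longleftrightarrow> (\<exists>u :: nat \<Rightarrow> real. (\<forall>i\<in>S. 0 \<le> u i) \<and> 0 < sum u S \<and>
     (\<Sum>i\<in>S. of_real (u i) * g i) = 0)"

section \<open>Both ranges in terms of isotropic subspaces and balanced sets\<close>

lemma isotropic_cong:
  assumes "\<And>i. i < N \<Longrightarrow> g i = h i"
  shows "isotropic N k g \<longleftrightarrow> isotropic N k h"
proof -
  have "(\<Sum>i<N. g i * (cnj (x i a) * x i b)) = (\<Sum>i<N. h i * (cnj (x i a) * x i b))"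
    for x :: "nat \<Rightarrow> nat \<Rightarrow> complex" and a b
    using assms by (intro sum.cong) auto
  then show ?thesis
    by (simp add: isotropic_def)
qed

lemma balanced_cong:
  assumes "\<And>i. i \<in> S \<Longrightarrow> g i = h i"
  shows "balanced S g \<longleftrightarrow> balanced S h"
proof -
  have "(\<Sum>i\<in>S. of_real (u i) * g i) = (\<Sum>i\<in>S. of_real (u i) * h i)" for u :: "nat \<Rightarrow> real"
    using assms by (intro sum.cong) auto
  then show ?thesis
    by (simp add: balanced_def)
qed

lemma full_col_rank_iff:
  "full_col_rank n k (mat n k (\<lambda>(i, a). x i a)) \<longleftrightarrow>
     (\<forall>c. (\<forall>i<n. (\<Sum>a<k. x i a * c a) = 0) \<longrightarrow> (\<forall>a<k. c a = 0))"
proof -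
  have eq: "mat n k (\<lambda>(i, a). x i a) *\<^sub>v c = 0\<^sub>v n \<longleftrightarrow> (\<forall>i<n. (\<Sum>a<k. x i a * c $ a) = 0)"
    if "c \<in> carrier_vec k" for c
    using that by (auto simp: vec_eq_iff scalar_prod_def lessThan_atLeast0)
  have eq0: "c = 0\<^sub>v k \<longleftrightarrow> (\<forall>a<k. c $ a = 0)" if "c \<in> carrier_vec k" for c :: "complex vec"
    using that by (auto simp: vec_eq_iff)
  show ?thesis
  proof
    assume l: "full_col_rank n k (mat n k (\<lambda>(i, a). x i a))"
    show "\<forall>c. (\<forall>i<n. (\<Sum>a<k. x i a * c a) = 0) \<longrightarrow> (\<forall>a<k. c a = 0)"
    proof (intro allI impI)
      fix c a assume "\<forall>i<n. (\<Sum>a<k. x i a * c a) = 0" "a < k"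
      then show "c a = 0"
        using l eq[of "vec k c"] eq0[of "vec k c"] by (auto simp: full_col_rank_def)
    qed
  next
    assume "\<forall>c. (\<forall>i<n. (\<Sum>a<k. x i a * c a) = 0) \<longrightarrow> (\<forall>a<k. c a = 0)"
    then have "c = 0\<^sub>v k" if "c \<in> carrier_vec k" "mat n k (\<lambda>(i, a). x i a) *\<^sub>v c = 0\<^sub>v n" for c
      using that(2) unfolding eq[OF that(1)] eq0[OF that(1)] by blast
    then show "full_col_rank n k (mat n k (\<lambda>(i, a). x i a))"
      unfolding full_col_rank_def by (intro conjI ballI impI) auto
  qed
qed

lemma full_col_rank_unitary_mult:
  assumes W: "unitary_op n W" and X: "full_col_rank n k X"
  shows "full_col_rank n k (W * X)"
  unfolding full_col_rank_def
proof (intro conjI ballI impI)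
  have c: "W \<in> carrier_mat n n" "X \<in> carrier_mat n k" "mat_adjoint W \<in> carrier_mat n n"
    using assms by (auto simp: unitary_op_def full_col_rank_def)
  then show "W * X \<in> carrier_mat n k"
    by auto
  fix v assume v: "v \<in> carrier_vec k" "(W * X) *\<^sub>v v = 0\<^sub>v n"
  have "X *\<^sub>v v = mat_adjoint W *\<^sub>v (W *\<^sub>v (X *\<^sub>v v))"
    using W c v(1) by (simp add: unitary_op_def flip: assoc_mult_mat_vec[of _ n n _ n])
  also have "\<dots> = mat_adjoint W *\<^sub>v 0\<^sub>v n"
    using c v by (simp add: assoc_mult_mat_vec[of _ n n _ k])
  also have "\<dots> = 0\<^sub>v n"
    using c by (intro eq_vecI) auto
  finally show "v = 0\<^sub>v k"
    using X v by (simp add: full_col_rank_def)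
qed

text \<open>A basis \<open>X\<close> for the conjugated operator corresponds to \<open>V * X\<close>
  for the original one, with the same Gram matrix. The reverse inclusion is the same argument for
  the adjoint of \<open>W\<close>.\<close>

lemma higher_rank_range_unitary_conj:
  assumes T: "T \<in> carrier_mat n n" and W: "unitary_op n W"
  shows "\<Lambda> k (mat_adjoint W * T * W) = \<Lambda> k T"
proof -
  have c: "W \<in> carrier_mat n n" "mat_adjoint W \<in> carrier_mat n n"
    using W by (auto simp: unitary_op_def)
  have sub: "\<Lambda> k (mat_adjoint V * A * V) \<subseteq> \<Lambda> k A"
    if A: "A \<in> carrier_mat n n" and V: "unitary_op n V" for A V
  proof
    have c: "V \<in> carrier_mat n n" and VV: "mat_adjoint V * V = 1\<^sub>m n"
      using V by (auto simp: unitary_op_def)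
    fix z assume "z \<in> \<Lambda> k (mat_adjoint V * A * V)"
    then obtain X where X: "full_col_rank n k X"
      "mat_adjoint X * (mat_adjoint V * A * V) * X = z \<cdot>\<^sub>m (mat_adjoint X * X)"
      using A c by (subst (asm) higher_rank_range_iff[of _ n]) auto
    have Xc: "X \<in> carrier_mat n k"
      using X by (simp add: full_col_rank_def)
    have adj: "mat_adjoint (V * X) = mat_adjoint X * mat_adjoint V"
      using c Xc by (rule mat_adjoint_mult)
    have "mat_adjoint V * (V * X) = X"
      using c Xc VV by (simp flip: assoc_mult_mat_dim)
    then have "mat_adjoint (V * X) * (V * X) = mat_adjoint X * X"
      unfolding adj using c Xc by (simp add: assoc_mult_mat_dim)
    moreover have "mat_adjoint (V * X) * A * (V * X) = z \<cdot>\<^sub>m (mat_adjoint X * X)"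
      unfolding adj X(2)[symmetric] using c Xc A by (simp add: assoc_mult_mat_dim)
    ultimately show "z \<in> \<Lambda> k A"
      unfolding higher_rank_range_iff[OF A]
      using full_col_rank_unitary_mult[OF V X(1)] by metis
  qed
  have "unitary_op n (mat_adjoint W)"
    using W c by (simp add: unitary_op_def)
  moreover have "mat_adjoint (mat_adjoint W) * (mat_adjoint W * T * W) * mat_adjoint W = T"
  proof -
    have "W * (mat_adjoint W * T) = T"
      using W c T by (simp add: unitary_op_def flip: assoc_mult_mat_dim)
    moreover have "W * (mat_adjoint W * T * W) * mat_adjoint W = W * (mat_adjoint W * T) * (W * mat_adjoint W)"
      using c T by (simp add: assoc_mult_mat_dim)
    ultimately show ?thesis
      using W T by (simp only: mat_adjoint_adjoint) (simp add: unitary_op_def)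
  qed
  moreover have "mat_adjoint W * T * W \<in> carrier_mat n n"
    using c T by auto
  ultimately have "\<Lambda> k T \<subseteq> \<Lambda> k (mat_adjoint W * T * W)"
    using sub[of "mat_adjoint W * T * W" "mat_adjoint W"] by simp
  with sub[OF T W] show ?thesis
    by (rule equalityI)
qed

text \<open>Subtracting \<open>z\<close> times the Gram matrix from the compression replaces each
  diagonal entry \<open>f i\<close> by \<open>f i - z\<close>, which moves the point
  \<open>z\<close> to 0.\<close>

lemma higher_rank_range_mat_diag:
  "z \<in> \<Lambda> k (mat_diag n f) \<longleftrightarrow> isotropic n k (\<lambda>i. f i - z)"
proof -
  have eq: "mat_adjoint X * mat_diag n f * X = z \<cdot>\<^sub>m (mat_adjoint X * X) \<longleftrightarrow>
      (\<forall>a<k. \<forall>b<k. (\<Sum>i<n. (f i - z) * (cnj (X $$ (i, a)) * X $$ (i, b))) = 0)"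
    if X: "X \<in> carrier_mat n k" for X
  proof -
    have 1: "(mat_adjoint X * mat_diag n f * X) $$ (a, b) =
        (\<Sum>i<n. f i * (cnj (X $$ (i, a)) * X $$ (i, b)))" if "a < k" "b < k" for a b
    proof -
      have "mat_adjoint X * mat_diag n f = mat k n (\<lambda>(a, i). cnj (X $$ (i, a)) * f i)"
        using X by (subst mat_diag_mult_right[of _ k]) (auto intro!: eq_matI)
      then show ?thesis
        using that X by (subst index_mat_mult_sum[of _ k n _ k]) (auto intro!: sum.cong)
    qed
    have 2: "(mat_adjoint X * X) $$ (a, b) = (\<Sum>i<n. cnj (X $$ (i, a)) * X $$ (i, b))"
      if "a < k" "b < k" for a b
      using that X by (subst index_mat_mult_sum[of _ k n _ k]) (auto intro!: sum.cong)
    have "mat_adjoint X * mat_diag n f * X = z \<cdot>\<^sub>m (mat_adjoint X * X) \<longleftrightarrow>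
      (\<forall>a<k. \<forall>b<k. (mat_adjoint X * mat_diag n f * X) $$ (a, b) = z * (mat_adjoint X * X) $$ (a, b))"
      using X by (auto simp: mat_eq_iff)
    also have "\<dots> \<longleftrightarrow> (\<forall>a<k. \<forall>b<k. (\<Sum>i<n. (f i - z) * (cnj (X $$ (i, a)) * X $$ (i, b))) = 0)"
      by (simp add: 1 2 left_diff_distrib sum_subtractf sum_distrib_left)
    finally show ?thesis .
  qed
  show ?thesis
    unfolding higher_rank_range_iff[OF mat_diag_dim]
  proof
    assume "\<exists>X. full_col_rank n k X \<and> mat_adjoint X * mat_diag n f * X = z \<cdot>\<^sub>m (mat_adjoint X * X)"
    then obtain X where X: "full_col_rank n k X"
      "mat_adjoint X * mat_diag n f * X = z \<cdot>\<^sub>m (mat_adjoint X * X)" by blast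
    have Xc: "X \<in> carrier_mat n k"
      using X by (simp add: full_col_rank_def)
    then have "mat n k (\<lambda>(i, a). X $$ (i, a)) = X"
      by (intro eq_matI) auto
    then show "isotropic n k (\<lambda>i. f i - z)"
      unfolding isotropic_def
      using full_col_rank_iff[of n k "\<lambda>i a. X $$ (i, a)"] X eq[OF Xc]
      by (intro exI[of _ "\<lambda>i a. X $$ (i, a)"]) auto
  next
    assume "isotropic n k (\<lambda>i. f i - z)"
    then obtain x where x: "full_col_rank n k (mat n k (\<lambda>(i, a). x i a))"
      "\<forall>a<k. \<forall>b<k. (\<Sum>i<n. (f i - z) * (cnj (x i a) * x i b)) = 0"
      unfolding isotropic_def full_col_rank_iff by blast
    then show "\<exists>X. full_col_rank n k X \<and> mat_adjoint X * mat_diag n f * X = z \<cdot>\<^sub>m (mat_adjoint X * X)"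
      using eq[of "mat n k (\<lambda>(i, a). x i a)"] by (intro exI[of _ "mat n k (\<lambda>(i, a). x i a)"]) simp
  qed
qed

lemma convex_hull_image_iff_balanced:
  assumes S: "finite S"
  shows "z \<in> convex hull (f ` S) \<longleftrightarrow> balanced S (\<lambda>i. f i - z)"
proof
  assume "z \<in> convex hull (f ` S)"
  then obtain v where v: "\<forall>x\<in>f ` S. 0 \<le> v x" "sum v (f ` S) = 1" "(\<Sum>x\<in>f ` S. v x *\<^sub>R x) = z"
    using S by (auto simp: convex_hull_finite)
  \<comment> \<open>Convex weights belong to values, balanced weights to indices: the weight of a
    value is shared equally among the indices in \<open>S\<close> that carry it.\<close>
  define w where "w i = v (f i) / card {j \<in> S. f j = f i}" for i
  \<comment> \<open>Used with \<open>h\<close> constantly 1 for the total weight and with the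
    identity for the barycentre.\<close>
  have split: "(\<Sum>i\<in>S. h (f i) * of_real (w i)) = (\<Sum>x\<in>f ` S. h x * of_real (v x))" for h :: "complex \<Rightarrow> complex"
  proof -
    have "(\<Sum>i\<in>S. h (f i) * of_real (w i)) = (\<Sum>x\<in>f ` S. \<Sum>i\<in>{j\<in>S. f j = x}. h (f i) * of_real (w i))"
      using S by (rule sum.image_gen)
    also have "\<dots> = (\<Sum>x\<in>f ` S. h x * of_real (v x))"
    proof (rule sum.cong[OF refl])
      fix x assume "x \<in> f ` S"
      then have "card {j \<in> S. f j = x} \<noteq> 0"
        using S by auto
      moreover have "(\<Sum>i\<in>{j\<in>S. f j = x}. h (f i) * of_real (w i)) =
          (\<Sum>i\<in>{j\<in>S. f j = x}. h x * of_real (v x / card {j \<in> S. f j = x}))"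
        by (rule sum.cong) (auto simp: w_def)
      ultimately show "(\<Sum>i\<in>{j\<in>S. f j = x}. h (f i) * of_real (w i)) = h x * of_real (v x)"
        by simp
    qed
    finally show ?thesis .
  qed
  have "complex_of_real (sum w S) = complex_of_real (sum v (f ` S))"
    using split[of "\<lambda>_. 1"] by simp
  then have 1: "sum w S = 1"
    using v(2) by (simp only: of_real_eq_iff)
  moreover have "(\<Sum>i\<in>S. of_real (w i) * f i) = z"
    using split[of "\<lambda>x. x"] v(3) by (simp add: scaleR_conv_of_real mult.commute)
  ultimately have "(\<Sum>i\<in>S. of_real (w i) * (f i - z)) = 0"
    by (simp add: right_diff_distrib sum_subtractf flip: sum_distrib_right of_real_sum)
  then show "balanced S (\<lambda>i. f i - z)"
    unfolding balanced_def using 1 v(1) by (intro exI[of _ w]) (auto simp: w_def)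
next
  assume "balanced S (\<lambda>i. f i - z)"
  then obtain u where u: "\<forall>i\<in>S. 0 \<le> u i" "0 < sum u S" "(\<Sum>i\<in>S. of_real (u i) * (f i - z)) = 0"
    by (auto simp: balanced_def)
  have "(\<Sum>i\<in>S. of_real (u i) * f i) = of_real (sum u S) * z"
    using u(3) by (simp add: right_diff_distrib sum_subtractf sum_distrib_right)
  moreover have "complex_of_real (sum u S) \<noteq> 0"
    using u(2) by (simp only: of_real_eq_0_iff)
  ultimately have "z = (\<Sum>i\<in>S. of_real (u i) * f i) / of_real (sum u S)"
    by simp
  also have "\<dots> = (\<Sum>i\<in>S. (u i / sum u S) *\<^sub>R f i)"
    by (simp add: scaleR_conv_of_real sum_divide_distrib)
  also have "\<dots> \<in> convex hull (f ` S)"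
    using u(1,2) S
    by (intro convex_sum[OF S convex_convex_hull]) (auto simp: hull_inc simp flip: sum_divide_distrib)
  finally show "z \<in> convex hull (f ` S)" .
qed

lemma Omega_iff_balanced:
  assumes "T \<in> carrier_mat N N" "eigenvalue_listing T ls"
  shows "z \<in> \<Omega> k T \<longleftrightarrow>
    (\<forall>S. S \<subseteq> {..<N} \<and> card S = N - k + 1 \<longrightarrow> balanced S (\<lambda>i. ls ! i - z))"
proof -
  have "(z \<in> convex hull (!) ls ` S) = balanced S (\<lambda>i. ls ! i - z)" if "S \<subseteq> {..<N}" for S
    using convex_hull_image_iff_balanced[of S z "(!) ls"] that finite_subset by blast
  then show ?thesis
    unfolding Omega_eq[OF assms] by auto
qed

text \<open>The factors are absorbed into the weights; the new total is positive because some old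
  weight is.\<close>

lemma balanced_scale:
  assumes "finite S" and r: "\<And>i. i \<in> S \<Longrightarrow> 0 < r i" and g: "balanced S (\<lambda>i. of_real (r i) * g i)"
  shows "balanced S g"
proof -
  obtain u where u: "\<forall>i\<in>S. 0 \<le> u i" "0 < sum u S" "(\<Sum>i\<in>S. of_real (u i) * (of_real (r i) * g i)) = 0"
    using g by (auto simp: balanced_def)
  have "\<exists>j\<in>S. u j \<noteq> 0"
    using u(2) sum.neutral[of S u] by (metis less_irrefl)
  then obtain j where "j \<in> S" "u j \<noteq> 0"
    by blast
  then have "0 < (\<Sum>i\<in>S. u i * r i)"
    using u(1) r assms(1) by (intro sum_pos2[of S j]) (auto intro!: mult_pos_pos mult_nonneg_nonneg less_imp_le simp: less_le)
  then show ?thesis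
    unfolding balanced_def using u(1,3) r
    by (intro exI[of _ "\<lambda>i. u i * r i"]) (auto simp: mult.assoc less_imp_le)
qed

lemma isotropic_scale:
  assumes r: "\<And>i. i < n \<Longrightarrow> 0 < r i" and g: "isotropic n k (\<lambda>i. of_real (r i) * g i)"
  shows "isotropic n k g"
proof -
  obtain x where inj: "\<And>c. (\<forall>i<n. (\<Sum>a<k. x i a * c a) = 0) \<Longrightarrow> (\<forall>a<k. c a = 0)"
    and x: "\<And>a b. a < k \<Longrightarrow> b < k \<Longrightarrow> (\<Sum>i<n. of_real (r i) * g i * (cnj (x i a) * x i b)) = 0"
    using g unfolding isotropic_def by blast
  \<comment> \<open>The form is quadratic in row \<open>i\<close>, so scaling that row by the square
    root moves \<open>r i\<close> from the form into the basis. The factor is nonzero, so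
    independence persists.\<close>
  define y where "y i a = of_real (sqrt (r i)) * x i a" for i a
  have "\<forall>a<k. c a = 0" if "\<forall>i<n. (\<Sum>a<k. y i a * c a) = 0" for c
  proof (rule inj, intro allI impI)
    fix i assume i: "i < n"
    have "(\<Sum>a<k. y i a * c a) = of_real (sqrt (r i)) * (\<Sum>a<k. x i a * c a)"
      by (simp add: y_def sum_distrib_left mult.assoc)
    then show "(\<Sum>a<k. x i a * c a) = 0"
      using that i r[OF i] by simp
  qed
  moreover have "(\<Sum>i<n. g i * (cnj (y i a) * y i b)) = 0" if "a < k" "b < k" for a b
  proof -
    have "cnj (y i a) * y i b = of_real (r i) * (cnj (x i a) * x i b)" if "i < n" for i
    proof -
      have "cnj (y i a) * y i b = of_real (sqrt (r i) * sqrt (r i)) * (cnj (x i a) * x i b)"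
        unfolding y_def by (simp only: complex_cnj_mult complex_cnj_complex_of_real of_real_mult ac_simps)
      then show ?thesis
        using r[OF that] by simp
    qed
    then have "(\<Sum>i<n. g i * (cnj (y i a) * y i b)) = (\<Sum>i<n. of_real (r i) * g i * (cnj (x i a) * x i b))"
      by (intro sum.cong) (simp_all only: lessThan_iff mult.left_commute mult.assoc)
    then show ?thesis
      using x[OF that] by simp
  qed
  ultimately show ?thesis
    unfolding isotropic_def by (intro exI[of _ y]) blast
qed

text \<open>Vanishing at the \<open>k - 1\<close> indices outside \<open>S\<close> cannot exclude
  every nonzero vector of a \<open>k\<close>-dimensional subspace. A surviving vector
  \<open>v\<close> is supported on \<open>S\<close>, and its squared moduli are the weights.\<close>

lemma isotropic_imp_balanced:
  assumes k: "1 \<le> k" "k \<le> N" and g: "isotropic N k g" and S: "S \<subseteq> {..<N}" "card S = N - k + 1"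
  shows "balanced S g"
proof -
  obtain x where inj: "\<And>c. (\<forall>i<N. (\<Sum>a<k. x i a * c a) = 0) \<Longrightarrow> (\<forall>a<k. c a = 0)"
    and x: "\<And>a b. a < k \<Longrightarrow> b < k \<Longrightarrow> (\<Sum>i<N. g i * (cnj (x i a) * x i b)) = 0"
    using g unfolding isotropic_def by blast
  have fin: "finite S"
    using S(1) finite_subset by blast
  have "card ({..<N} - S) = k - 1"
    using S k fin by (subst card_Diff_subset) auto
  then obtain e where e: "bij_betw e {0..<k - 1} ({..<N} - S)"
    using ex_bij_betw_nat_finite[of "{..<N} - S"] by auto
  \<comment> \<open>The \<open>k - 1\<close> conditions are padded by a zero row at index
    \<open>k - 1\<close>. The square matrix is then singular, and a kernel vector gives the
    coefficients of \<open>v\<close>.\<close>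
  define Y where "Y = mat k k (\<lambda>(r, a). if r < k - 1 then x (e r) a else 0)"
  have Y: "Y \<in> carrier_mat k k"
    by (simp add: Y_def)
  have "Y = mat\<^sub>r k k (\<lambda>r. if r = k - 1 then 0\<^sub>v k else vec k (x (e r)))"
    by (rule eq_matI) (auto simp: Y_def)
  then have "det Y = 0"
    using k det_row_0[of "k - 1" k "\<lambda>r. vec k (x (e r))"] by simp
  then obtain c where c: "c \<in> carrier_vec k" "c \<noteq> 0\<^sub>v k" "Y *\<^sub>v c = 0\<^sub>v k"
    using det_0_iff_vec_prod_zero[OF Y] by blast
  define v where "v i = (\<Sum>a<k. x i a * c $ a)" for i
  have v_out: "v i = 0" if "i \<in> {..<N} - S" for i
  proof -
    have "i \<in> e ` {0..<k - 1}"
      using that bij_betw_imp_surj_on[OF e] by simp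
    then obtain r where r: "r < k - 1" "i = e r"
      by auto
    have "(Y *\<^sub>v c) $ r = v i"
      using r c(1) by (auto simp: Y_def v_def scalar_prod_def lessThan_atLeast0)
    then show ?thesis
      using c r by simp
  qed
  obtain j where j: "j < N" "v j \<noteq> 0"
  proof -
    have "\<not> (\<forall>a<k. c $ a = 0)"
      using c(1,2) by (auto simp: vec_eq_iff)
    then have "\<not> (\<forall>i<N. v i = 0)"
      unfolding v_def using inj[of "\<lambda>a. c $ a"] by blast
    then show ?thesis
      using that by blast
  qed
  then have jS: "j \<in> S"
    using v_out by blast
  have "(\<Sum>i<N. g i * (cnj (v i) * v i)) =
      (\<Sum>i<N. \<Sum>a<k. \<Sum>b<k. cnj (c $ a) * c $ b * (g i * (cnj (x i a) * x i b)))"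
    by (auto simp: v_def sum_product sum_distrib_left ac_simps intro!: sum.cong)
  also have "\<dots> = (\<Sum>a<k. \<Sum>b<k. cnj (c $ a) * c $ b * (\<Sum>i<N. g i * (cnj (x i a) * x i b)))"
    unfolding sum_distrib_left
    by (subst sum.swap, rule sum.cong[OF refl], subst sum.swap, rule refl)
  also have "\<dots> = 0"
    using x by simp
  finally have "(\<Sum>i<N. g i * (cnj (v i) * v i)) = 0" .
  also have "(\<Sum>i<N. g i * (cnj (v i) * v i)) = (\<Sum>i\<in>S. g i * (cnj (v i) * v i))"
    using S v_out by (intro sum.mono_neutral_right) auto
  finally have "(\<Sum>i\<in>S. of_real ((cmod (v i))\<^sup>2) * g i) = 0"
    by (simp add: mult_cnj_eq mult.commute)
  moreover have "0 < (\<Sum>i\<in>S. (cmod (v i))\<^sup>2)"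
    using j jS fin by (intro sum_pos2[of S j]) auto
  ultimately show ?thesis
    unfolding balanced_def by (intro exI[of _ "\<lambda>i. (cmod (v i))\<^sup>2"]) auto
qed

section \<open>Reduction to unitary operators\<close>

lemma isotropic_0 [simp]: "isotropic n 0 g"
  by (simp add: isotropic_def)

text \<open>Coordinate vectors at the zero entries lie in the kernel of the form, so they can be
  adjoined to an isotropic subspace; the last size bound guarantees enough of them.\<close>

lemma isotropic_append_zeros:
  assumes g: "isotropic n k' g" and zero: "\<And>i. n \<le> i \<Longrightarrow> i < N \<Longrightarrow> g i = 0"
    and le: "n \<le> N" "k' \<le> k" "k - k' \<le> N - n"
  shows "isotropic N k g"
proof -
  obtain x where inj: "\<And>c. (\<forall>i<n. (\<Sum>a<k'. x i a * c a) = 0) \<Longrightarrow> (\<forall>a<k'. c a = 0)"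
    and x: "\<And>a b. a < k' \<Longrightarrow> b < k' \<Longrightarrow> (\<Sum>i<n. g i * (cnj (x i a) * x i b)) = 0"
    using g unfolding isotropic_def by blast
  \<comment> \<open>Columns below \<open>k'\<close> are the old vectors extended by zeros; column
    \<open>k' + l\<close> is the unit vector at index \<open>n + l\<close>.\<close>
  define y where "y i a =
    (if i < n then if a < k' then x i a else 0 else if a = k' + (i - n) then 1 else 0)" for i a
  have "\<forall>a<k. c a = 0" if c: "\<forall>i<N. (\<Sum>a<k. y i a * c a) = 0" for c
  proof -
    have "\<forall>a<k'. c a = 0"
    proof (rule inj, intro allI impI)
      fix i assume i: "i < n"
      have "(\<Sum>a<k'. x i a * c a) = (\<Sum>a<k. y i a * c a)"
        using le i by (intro sum.mono_neutral_cong_left) (auto simp: y_def)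
      then show "(\<Sum>a<k'. x i a * c a) = 0"
        using c i le by simp
    qed
    moreover have "c a = 0" if a: "k' \<le> a" "a < k" for a
    proof -
      have "(\<Sum>b<k. y (n + (a - k')) b * c b) = (\<Sum>b<k. if b = a then c b else 0)"
        using a by (intro sum.cong) (auto simp: y_def)
      then show ?thesis
        using c a le by auto
    qed
    ultimately show ?thesis
      using not_le by blast
  qed
  moreover have "(\<Sum>i<N. g i * (cnj (y i a) * y i b)) = 0" if "a < k" "b < k" for a b
  proof -
    have "(\<Sum>i<N. g i * (cnj (y i a) * y i b)) = (\<Sum>i<n. g i * (cnj (y i a) * y i b))"
      using le zero by (intro sum.mono_neutral_right) auto
    also have "\<dots> = 0"
    proof (cases "a < k' \<and> b < k'")
      case True
      then show ?thesis
        using x by (simp add: y_def)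
    qed (auto simp: y_def intro!: sum.neutral)
    finally show ?thesis .
  qed
  ultimately show ?thesis
    unfolding isotropic_def by (intro exI[of _ y]) blast
qed

section \<open>Diagonal unitaries and the two inclusions for normal operators\<close>

lemma proots_prod_list_linear: "proots (\<Prod>a\<leftarrow>ls. [:- a, 1:]) = mset ls"
  for ls :: "'a :: idom list"
proof (induction ls)
  case (Cons a ls)
  have "(\<Prod>a\<leftarrow>ls. [:- a, 1:]) \<noteq> 0"
    by (auto simp: prod_list_zero_iff)
  then show ?case
    using Cons.IH by (simp add: proots_mult del: mult_pCons_left)
qed simp

lemma eigenvalue_listing_mat_diag: "eigenvalue_listing (mat_diag n f) (map f [0..<n])"
proof -
  have "diag_mat (mat_diag n f) = map f [0..<n]"
    by (auto simp: diag_mat_def mat_diag_def)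
  moreover have "upper_triangular (mat_diag n f)"
    by (auto simp: mat_diag_def)
  ultimately have "char_poly (mat_diag n f) = (\<Prod>a\<leftarrow>map f [0..<n]. [:- a, 1:])"
    by (simp only: char_poly_upper_triangular[OF mat_diag_dim])
  then show ?thesis
    by (simp only: eigenvalue_listing_def proots_prod_list_linear)
qed

lemma unitary_op_mat_diag:
  assumes "\<And>i. i < n \<Longrightarrow> cmod (f i) = 1"
  shows "unitary_op n (mat_diag n f)"
proof (rule unitary_opI)
  have "mat_adjoint (mat_diag n f) * mat_diag n f = mat_diag n (\<lambda>i. f i * cnj (f i))"
    by (simp add: mat_adjoint_mat_diag mult.commute)
  also have "\<dots> = 1\<^sub>m n"
    using assms by (intro eq_matI) (auto simp: mat_diag_def mult_cnj_eq)
  finally show "mat_adjoint (mat_diag n f) * mat_diag n f = 1\<^sub>m n" .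
qed simp

lemma unitary_imp_normal: "unitary_op n U \<Longrightarrow> normal_op n U"
  by (simp add: unitary_op_def normal_op_def)

text \<open>Diagonalization respects the order of the list, so the listing may be chosen freely;
  this later allows the eigenvalues equal to \<open>z\<close> to be put last.\<close>

lemma higher_rank_range_iff_isotropic:
  assumes T: "normal_op N T" and ls: "eigenvalue_listing T ls"
  shows "z \<in> \<Lambda> k T \<longleftrightarrow> isotropic N k (\<lambda>i. ls ! i - z)"
proof -
  have Tc: "T \<in> carrier_mat N N"
    using T by (simp add: normal_op_def)
  obtain W where W: "unitary_op N W" "mat_adjoint W * T * W = mat_diag N (\<lambda>i. ls ! i)"
    using normal_op_diagonalization[OF T eigenvalue_listing_char_poly(2)[OF Tc ls]] by blast
  show ?thesis
    unfolding higher_rank_range_unitary_conj[OF Tc W(1), symmetric] W(2)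
    by (rule higher_rank_range_mat_diag)
qed

lemma higher_rank_range_subset_Omega:
  assumes T: "normal_op N T" and k: "1 \<le> k" "k \<le> N"
  shows "\<Lambda> k T \<subseteq> \<Omega> k T"
proof
  fix z assume z: "z \<in> \<Lambda> k T"
  obtain ls where ls: "eigenvalue_listing T ls"
    using eigenvalue_listing_exists by blast
  have "T \<in> carrier_mat N N"
    using T by (simp add: normal_op_def)
  then show "z \<in> \<Omega> k T"
    using z isotropic_imp_balanced[OF k]
    by (simp add: Omega_iff_balanced[OF _ ls] higher_rank_range_iff_isotropic[OF T ls])
qed

text \<open>The hypothesis on unitaries is applied at the point 0 to the diagonal matrix of phases.
  As the entries of \<open>g\<close> are nonzero, they differ from their phases by positive factors,
  which affect neither balance nor isotropy.\<close>

lemma isotropic_if_balanced_sets: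
  assumes U: "\<And>N k U. 1 \<le> k \<Longrightarrow> k \<le> N \<Longrightarrow> unitary_op N U \<Longrightarrow> \<Omega> k U \<subseteq> \<Lambda> k U"
    and k: "1 \<le> k" "k \<le> N" and g: "\<And>i. i < N \<Longrightarrow> g i \<noteq> 0"
    and bal: "\<And>S. S \<subseteq> {..<N} \<Longrightarrow> card S = N - k + 1 \<Longrightarrow> balanced S g"
  shows "isotropic N k g"
proof -
  define f where "f i = sgn (g i)" for i
  define ls where "ls = map f [0..<N]"
  have un: "unitary_op N (mat_diag N f)"
    using g by (intro unitary_op_mat_diag) (simp add: f_def norm_sgn)
  have ls: "eigenvalue_listing (mat_diag N f) ls"
    unfolding ls_def by (rule eigenvalue_listing_mat_diag)
  have polar: "g i = of_real (cmod (g i)) * f i" "f i = of_real (1 / cmod (g i)) * g i" if "i < N" for i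
    using g[OF that] by (auto simp: f_def sgn_eq)
  have "0 \<in> \<Omega> k (mat_diag N f)"
    unfolding Omega_iff_balanced[OF mat_diag_dim ls]
  proof (intro allI impI, elim conjE)
    fix S :: "nat set" assume S: "S \<subseteq> {..<N}" "card S = N - k + 1"
    have lt: "i < N" if "i \<in> S" for i
      using that S(1) by blast
    have "balanced S (\<lambda>i. of_real (cmod (g i)) * f i) \<longleftrightarrow> balanced S g"
      by (rule balanced_cong) (simp only: lt flip: polar(1))
    then have "balanced S (\<lambda>i. of_real (cmod (g i)) * f i)"
      using bal[OF S] by simp
    moreover have "finite S"
      using S(1) finite_subset by blast
    ultimately have "balanced S f"
      using g lt by (blast intro: balanced_scale[where r = "\<lambda>i. cmod (g i)"] zero_less_norm_iff[THEN iffD2])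
    moreover have "balanced S (\<lambda>i. ls ! i - 0) \<longleftrightarrow> balanced S f"
      by (rule balanced_cong) (simp add: lt ls_def)
    ultimately show "balanced S (\<lambda>i. ls ! i - 0)"
      by simp
  qed
  then have "0 \<in> \<Lambda> k (mat_diag N f)"
    using U[OF k un] by blast
  then have "isotropic N k f"
    by (simp add: higher_rank_range_mat_diag)
  then have "isotropic N k (\<lambda>i. of_real (1 / cmod (g i)) * g i)"
    using polar(2) by (subst isotropic_cong) auto
  then show ?thesis
    by (rule isotropic_scale[rotated]) (use g in simp)
qed

lemma Omega_subset_higher_rank_range:
  assumes U: "\<And>N k U. 1 \<le> k \<Longrightarrow> k \<le> N \<Longrightarrow> unitary_op N U \<Longrightarrow> \<Omega> k U \<subseteq> \<Lambda> k U"
    and T: "normal_op N T" and k: "1 \<le> k" "k \<le> N"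
  shows "\<Omega> k T \<subseteq> \<Lambda> k T"
proof
  fix z assume z: "z \<in> \<Omega> k T"
  obtain ls0 where ls0: "eigenvalue_listing T ls0"
    using eigenvalue_listing_exists by blast
  define nz where "nz = filter (\<lambda>a. a \<noteq> z) ls0"
  \<comment> \<open>With the eigenvalues equal to \<open>z\<close> at the end, the zeros of
    \<open>g\<close> are exactly the indices from \<open>n\<close> to \<open>N - 1\<close>.\<close>
  define ls where "ls = nz @ filter (\<lambda>a. a = z) ls0"
  define n where "n = length nz"
  define g where "g i = ls ! i - z" for i
  have "mset ls = mset ls0"
    by (simp add: ls_def nz_def)
  then have ls: "eigenvalue_listing T ls"
    using ls0 by (simp add: eigenvalue_listing_def)
  have Tc: "T \<in> carrier_mat N N"
    using T by (simp add: normal_op_def)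
  have len: "length ls = N"
    using eigenvalue_listing_char_poly(1)[OF Tc ls] .
  have n: "n \<le> N"
    unfolding n_def len[symmetric] ls_def by simp
  have g_nz: "g i \<noteq> 0" if "i < n" for i
  proof -
    have "nz ! i \<in> set nz"
      using that by (simp add: n_def)
    then have "nz ! i \<noteq> z"
      by (simp add: nz_def)
    then show ?thesis
      using that by (simp add: g_def ls_def n_def nth_append)
  qed
  have g_z: "g i = 0" if "n \<le> i" "i < N" for i
  proof -
    have "filter (\<lambda>a. a = z) ls0 ! (i - n) \<in> set (filter (\<lambda>a. a = z) ls0)"
      by (rule nth_mem) (use that len in \<open>simp add: ls_def n_def\<close>)
    then show ?thesis
      using that by (simp add: g_def ls_def n_def nth_append)
  qed
  have bal: "balanced S g" if "S \<subseteq> {..<N}" "card S = N - k + 1" for S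
    using z that unfolding Omega_iff_balanced[OF Tc ls] g_def by blast
  \<comment> \<open>If \<open>k\<close> is at most the number of zeros, truncated subtraction gives
    the trivial subspace. Otherwise the set size for \<open>n\<close> and \<open>k - (N - n)\<close>
    is again \<open>N - k + 1\<close>, so \<open>bal\<close> applies to subsets of the nonzero
    indices.\<close>
  have "isotropic n (k - (N - n)) g"
  proof (cases "k \<le> N - n")
    case False
    then show ?thesis
      using k n g_nz by (intro isotropic_if_balanced_sets[OF U] bal) auto
  qed simp
  then have "isotropic N k g"
    by (rule isotropic_append_zeros) (use n k g_z in auto)
  then show "z \<in> \<Lambda> k T"
    by (simp add: higher_rank_range_iff_isotropic[OF T ls] flip: g_def)
qed

theorem proposition3p3:
  shows "(\<forall>N k T. 1 \<le> k \<and> k \<le> N \<and> normal_op N T \<longrightarrow> \<Lambda> k T = \<Omega> k T)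
     \<longleftrightarrow> (\<forall>N k U. 1 \<le> k \<and> k \<le> N \<and> unitary_op N U \<longrightarrow> \<Lambda> k U = \<Omega> k U)"
proof
  assume "\<forall>N k T. 1 \<le> k \<and> k \<le> N \<and> normal_op N T \<longrightarrow> \<Lambda> k T = \<Omega> k T"
  then show "\<forall>N k U. 1 \<le> k \<and> k \<le> N \<and> unitary_op N U \<longrightarrow> \<Lambda> k U = \<Omega> k U"
    using unitary_imp_normal by blast
next
  assume "\<forall>N k U. 1 \<le> k \<and> k \<le> N \<and> unitary_op N U \<longrightarrow> \<Lambda> k U = \<Omega> k U"
  \<comment> \<open>This inclusion is what has to be carried over to normal operators; the opposite
    one holds for all of them.\<close>
  then have U: "\<Omega> k U \<subseteq> \<Lambda> k U" if "1 \<le> k" "k \<le> N" "unitary_op N U" for N k U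
    using that by blast
  show "\<forall>N k T. 1 \<le> k \<and> k \<le> N \<and> normal_op N T \<longrightarrow> \<Lambda> k T = \<Omega> k T"
  proof (intro allI impI, elim conjE)
    fix N k T assume "1 \<le> k" "k \<le> N" "normal_op N T"
    then show "\<Lambda> k T = \<Omega> k T"
      by (intro equalityI higher_rank_range_subset_Omega Omega_subset_higher_rank_range[OF U])
  qed
qed

end
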